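(* Suppose that the planar Hamiltonian system $\dot x=J_2DH(x)$ possesses a hyperbolic saddle point $p$ connected to itself by a homoclinic orbit $q^{\mathrm h}(t)$. If the system $$\dot x=J_2DH(x)+\varepsilon g(x,\theta),\qquad \dot\theta=1,\qquad (x,\theta)\in\mathbb{R}^2\times\mathbb{S}^1_T,$$ has a $C^3$ first integral $F_\varepsilon(x,t)=H(x)+O(\varepsilon)$ (with $\theta=t \bmod T$) depending $C^2$-smoothly on $\varepsilon$ in a neighborhood of $$\Gamma^{\mathrm h}_{\tau_0}=\{(q^{\mathrm h}(t-\tau_0),t)\mid t\in\mathbb{R}\}$$ with $\tau_0\in\mathbb{S}^1_T$, then there exists a connected open set $\Pi\subset\mathbb{S}^1_T$ such that $\tau_0\in\Pi$ and the homoclinic Melnikov function $$M(\tau):=\int_{-\infty}^{\infty}DH(q^{\mathrm h}(t))\cdot g(q^{\mathrm h}(t),t+\tau)\,dt$$ is zero on $\Pi$.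
   Context: $\varepsilon$ is a small parameter with $0<\varepsilon\ll1$; the unperturbed system is the case $\varepsilon=0$. $T>0$ is a constant and $\mathbb{S}^1_T=\mathbb{R}/T\mathbb{Z}$; second components $t$ of points of $\mathbb{R}^2\times\mathbb{S}^1_T$ are read modulo $T$. $H:\mathbb{R}^2\to\mathbb{R}$ and $g:\mathbb{R}^2\times\mathbb{R}\to\mathbb{R}^2$ are, respectively, $C^3$ and $C^2$ in $x$, $g(x,t)$ is $T$-periodic in $t$, $J_2=\begin{pmatrix}0&1\\-1&0\end{pmatrix}$, and "$\cdot$" is the standard inner product in $\mathbb{R}^2$.
   Formalization: The neighborhood of Γ is required to contain the closure of Γ, i.e. also {p}×S¹_T (a tube of constant radius); for arbitrary open sets containing only Γ, such as tubes shrinking towards {p}×S¹_T, the claim is false. *)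

theory Defs
  imports "HOL-Analysis.Analysis" "HOL-Library.Landau_Symbols"
begin

(* For open S this is the usual class C^k.  The derivative is taken within S, so that on a set
   such as [0,e) x V, with V open, derivatives at the boundary 0 are one-sided; there the
   derivative within the set is still unique. *)
primrec Ck_on :: "nat \<Rightarrow> ('a::real_normed_vector \<Rightarrow> 'b::real_normed_vector) \<Rightarrow> 'a set \<Rightarrow> bool" where
  "Ck_on 0 f S \<longleftrightarrow> continuous_on S f"
| "Ck_on (Suc k) f S \<longleftrightarrow> (\<forall>x\<in>S. f differentiable (at x within S)) \<and>
     (\<forall>v. Ck_on k (\<lambda>x. frechet_derivative f (at x within S) v) S)"

definition grad :: "(real^2 \<Rightarrow> real) \<Rightarrow> real^2 \<Rightarrow> real^2" where
  "grad H x = (\<chi> i. frechet_derivative H (at x) (axis i 1))"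

definition J2 :: "real^2^2" where
  "J2 = vector [vector [0, 1], vector [-1, 0]]"

definition ham_field :: "(real^2 \<Rightarrow> real) \<Rightarrow> real^2 \<Rightarrow> real^2" where
  "ham_field H x = J2 *v grad H x"

definition hyperbolic_saddle :: "(real^2 \<Rightarrow> real^2) \<Rightarrow> real^2 \<Rightarrow> bool" where
  "hyperbolic_saddle f p \<longleftrightarrow> f p = 0 \<and> f differentiable (at p) \<and>
     (\<exists>l m. l < 0 \<and> 0 < m \<and>
        (\<exists>v. v \<noteq> 0 \<and> frechet_derivative f (at p) v = l *\<^sub>R v) \<and>
        (\<exists>w. w \<noteq> 0 \<and> frechet_derivative f (at p) w = m *\<^sub>R w))"

definition homoclinic_orbit :: "(real^2 \<Rightarrow> real^2) \<Rightarrow> real^2 \<Rightarrow> (real \<Rightarrow> real^2) \<Rightarrow> bool" where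
  "homoclinic_orbit f p q \<longleftrightarrow>
     (\<forall>t. (q has_vector_derivative f (q t)) (at t)) \<and>
     (\<exists>t. q t \<noteq> p) \<and> (q \<longlongrightarrow> p) at_top \<and> (q \<longlongrightarrow> p) at_bot"

(* The circle R/TZ, with its quotient topology; its points are the cosets t + TZ. *)
definition coset_mod :: "real \<Rightarrow> real \<Rightarrow> real set" where
  "coset_mod T t = {s. \<exists>k::int. s = t + of_int k * T}"

definition circle :: "real \<Rightarrow> real set topology" where
  "circle T = topology (\<lambda>P. P \<subseteq> range (coset_mod T) \<and> open (coset_mod T -` P))"

lemma openin_circle:
  "openin (circle T) P \<longleftrightarrow> P \<subseteq> range (coset_mod T) \<and> open (coset_mod T -` P)"
proof -
  have "istopology (\<lambda>P. P \<subseteq> range (coset_mod T) \<and> open (coset_mod T -` P))"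
    by (auto simp: istopology_def vimage_Union)
  then show ?thesis
    by (simp add: circle_def topology_inverse')
qed

lemma topspace_circle: "topspace (circle T) = range (coset_mod T)"
proof
  show "topspace (circle T) \<subseteq> range (coset_mod T)"
    using openin_circle[of T "topspace (circle T)"] by blast
  have "coset_mod T -` range (coset_mod T) = UNIV" by auto
  then have "openin (circle T) (range (coset_mod T))"
    by (simp add: openin_circle)
  then show "range (coset_mod T) \<subseteq> topspace (circle T)"
    by (rule openin_subset)
qed

lemma quotient_map_coset_mod: "quotient_map euclidean (circle T) (coset_mod T)"
  by (auto simp: quotient_map_def topspace_circle openin_circle vimage_def)

abbreviation phase_space :: "real \<Rightarrow> ((real^2) \<times> real set) topology" where
  "phase_space T \<equiv> prod_topology euclidean (circle T)"

(* Objects on the phase space, read on its covering space R^2 x R. *)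
definition lift_set :: "real \<Rightarrow> ((real^2) \<times> real set) set \<Rightarrow> ((real^2) \<times> real) set" where
  "lift_set T U = {(x, t). (x, coset_mod T t) \<in> U}"

definition lift_fun :: "real \<Rightarrow> ((real^2) \<times> real set \<Rightarrow> 'a) \<Rightarrow> (real^2) \<times> real \<Rightarrow> 'a" where
  "lift_fun T f = (\<lambda>(x, t). f (x, coset_mod T t))"

definition orbit_curve :: "real \<Rightarrow> (real \<Rightarrow> real^2) \<Rightarrow> real \<Rightarrow> ((real^2) \<times> real set) set" where
  "orbit_curve T q \<tau>0 = range (\<lambda>t. (q (t - \<tau>0), coset_mod T t))"

(* A neighbourhood of the curve in the uniform sense: its closure adds only {p} x R/TZ and is
   compact, so an open U contains the closure iff it contains a tube of some constant radius
   about the curve.  Open sets containing just the curve may shrink towards {p} x R/TZ; on such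
   a set that lifts injectively to the covering space, every perturbed system has the first
   integral obtained by flowing back to time 0 and applying H, whatever its Melnikov function. *)
definition uniform_nbhd :: "'a topology \<Rightarrow> 'a set \<Rightarrow> 'a set \<Rightarrow> bool" where
  "uniform_nbhd X G U \<longleftrightarrow> openin X U \<and> X closure_of G \<subseteq> U"

definition pert_field ::
  "(real^2 \<Rightarrow> real) \<Rightarrow> (real^2 \<Rightarrow> real \<Rightarrow> real^2) \<Rightarrow> real \<Rightarrow> (real^2) \<times> real \<Rightarrow> (real^2) \<times> real" where
  "pert_field H g \<epsilon> = (\<lambda>(x, t). (ham_field H x + \<epsilon> *\<^sub>R g x t, 1))"

definition first_integral_on ::
  "('a::real_normed_vector \<Rightarrow> 'a) \<Rightarrow> 'a set \<Rightarrow> ('a \<Rightarrow> real) \<Rightarrow> bool" where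
  "first_integral_on X V F \<longleftrightarrow>
     (\<forall>z\<in>V. F differentiable (at z) \<and> frechet_derivative F (at z) (X z) = 0)"

definition melnikov_integrand ::
  "(real^2 \<Rightarrow> real) \<Rightarrow> (real^2 \<Rightarrow> real \<Rightarrow> real^2) \<Rightarrow> (real \<Rightarrow> real^2) \<Rightarrow> real \<Rightarrow> real \<Rightarrow> real" where
  "melnikov_integrand H g q \<tau> t = grad H (q t) \<bullet> g (q t) (t + \<tau>)"

(* The Henstock-Kurzweil integral over the line, which includes convergent improper integrals;
   as it is 0 for divergent ones, statements about it should also assert convergence. *)
definition melnikov ::
  "(real^2 \<Rightarrow> real) \<Rightarrow> (real^2 \<Rightarrow> real \<Rightarrow> real^2) \<Rightarrow> (real \<Rightarrow> real^2) \<Rightarrow> real \<Rightarrow> real" where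
  "melnikov H g q \<tau> = integral UNIV (melnikov_integrand H g q \<tau>)"

end

theory Submission
  imports Defs
begin

text \<open>
  The proof expands the first integral to first order in the parameter. Let
  \<open>K = \<partial>F\<^sub>\<epsilon> / \<partial>\<epsilon>\<close> at \<open>\<epsilon> = 0\<close>, a differentiable function near the homoclinic
  curve, and write the perturbed field as \<open>X + \<epsilon> Y\<close>. The identity \<open>DF\<^sub>\<epsilon> (X + \<epsilon> Y) = 0\<close> differentiated
  in \<open>\<epsilon>\<close> at \<open>0\<close> reads \<open>DK X = - DF\<^sub>0 Y\<close>, where \<open>F\<^sub>0 = H\<close>. Hence along every solution \<open>y\<close>
  of the unperturbed system the function \<open>s \<mapsto> K (y s, s + \<tau>)\<close> has derivative
  \<open>- DH (y s) \<bullet> g (y s, s + \<tau>)\<close>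
  (\<open>first_order_coeff_derivative\<close>, \<open>first_order_coeff_along_unperturbed_solution\<close>): minus the
  Melnikov integrand when \<open>y = q\<close>, and zero when \<open>y\<close> rests at the saddle \<open>p\<close>, because \<open>DH p = 0\<close>.

  So \<open>K\<close> takes one value \<open>c\<close> on the whole periodic orbit \<open>{p} \<times> \<real>/T\<int>\<close>. This circle lies in
  the closure of the homoclinic curve (\<open>limit_circle_in_closure\<close>), hence in the neighbourhood on
  which \<open>K\<close> lives, and it is compact, so \<open>K (q s, s + \<tau>) \<longrightarrow> c\<close> as
  \<open>s \<longrightarrow> \<plusminus>\<infinity>\<close>, although the phase \<open>s + \<tau>\<close> itself does not converge
  (\<open>tendsto_of_constant_on_limit_circle\<close>). The fundamental theorem of calculus on the line
  (\<open>has_integral_UNIV_of_limits\<close>) yields convergence of the Melnikov integral and the value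
  \<open>c - c = 0\<close>. The argument applies to every phase \<open>\<tau>\<close> whose homoclinic curve stays in the
  neighbourhood, and by compactness these phases include an interval about \<open>\<tau>0\<close>
  (\<open>nearby_phases_stay_in_nbhd\<close>).
\<close>

section \<open>Mixed second derivatives on the boundary of a half-open parameter interval\<close>

lemma Ck_on_SucD:
  assumes "Ck_on (Suc k) f S"
  shows "x \<in> S \<Longrightarrow> (f has_derivative frechet_derivative f (at x within S)) (at x within S)"
    and "Ck_on k (\<lambda>x. frechet_derivative f (at x within S) v) S"
  using assms by (auto simp: frechet_derivative_works)

lemma Ck_on_Suc_continuous_on: "Ck_on (Suc k) f S \<Longrightarrow> continuous_on S f"
  by (auto simp: continuous_on_eq_continuous_within intro: differentiable_imp_continuous_within)

lemma slice_has_derivative: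
  assumes \<Phi>: "(\<Phi> has_derivative D) (at (\<epsilon>, z) within I \<times> W)"
    and W: "open W" "z \<in> W" and \<epsilon>: "\<epsilon> \<in> I"
  shows "((\<lambda>w. \<Phi> (\<epsilon>, w)) has_derivative (\<lambda>w. D (0, w))) (at z)"
proof -
  have "((\<lambda>w. (\<epsilon>, w)) has_derivative (\<lambda>w. (0, w))) (at z within W)"
    by (auto intro!: derivative_eq_intros)
  moreover have "(\<Phi> has_derivative D) (at (\<epsilon>, z) within (\<lambda>w. (\<epsilon>, w)) ` W)"
    by (rule has_derivative_subset[OF \<Phi>]) (use \<epsilon> in auto)
  ultimately have "((\<lambda>w. \<Phi> (\<epsilon>, w)) has_derivative (\<lambda>w. D (0, w))) (at z within W)"
    by (rule has_derivative_in_compose)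
  then show ?thesis
    unfolding at_within_open[OF W(2,1)] .
qed

lemma line_has_vector_derivative:
  assumes "(f has_derivative D) (at (z + s *\<^sub>R v))"
  shows "((\<lambda>s. f (z + s *\<^sub>R v)) has_vector_derivative D v) (at s within X)"
proof -
  have "((\<lambda>s. z + s *\<^sub>R v) has_derivative (\<lambda>h. h *\<^sub>R v)) (at s within X)"
    by (auto intro!: derivative_eq_intros)
  then have "((\<lambda>s. f (z + s *\<^sub>R v)) has_derivative (\<lambda>h. D (h *\<^sub>R v))) (at s within X)"
    using assms by (rule has_derivative_compose)
  moreover have "D (h *\<^sub>R v) = h *\<^sub>R D v" for h
    using has_derivative_linear[OF assms] by (rule linear_scale)
  ultimately show ?thesis
    by (simp add: has_vector_derivative_def)
qed

lemma parameter_has_vector_derivative: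
  assumes \<Phi>: "(\<Phi> has_derivative D) (at (\<epsilon>, z) within I \<times> W)" and z: "z \<in> W"
  shows "((\<lambda>\<epsilon>. \<Phi> (\<epsilon>, z)) has_vector_derivative D (1, 0)) (at \<epsilon> within I)"
proof -
  have "((\<lambda>\<epsilon>. (\<epsilon>, z)) has_derivative (\<lambda>h. (h, 0))) (at \<epsilon> within I)"
    by (auto intro!: derivative_eq_intros)
  moreover have "(\<Phi> has_derivative D) (at (\<epsilon>, z) within (\<lambda>\<epsilon>. (\<epsilon>, z)) ` I)"
    by (rule has_derivative_subset[OF \<Phi>]) (use z in auto)
  ultimately have "((\<lambda>\<epsilon>. \<Phi> (\<epsilon>, z)) has_derivative (\<lambda>h. D (h, 0))) (at \<epsilon> within I)"
    by (rule has_derivative_in_compose)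
  moreover have "(\<lambda>h. D (h, 0)) = (\<lambda>h. h *\<^sub>R D (1, 0))"
  proof
    show "D (h, 0) = h *\<^sub>R D (1, 0)" for h
      using linear_scale[OF has_derivative_linear[OF \<Phi>], of h "(1, 0)"] by simp
  qed
  ultimately show ?thesis
    unfolding has_vector_derivative_def by (simp only:)
qed

text \<open>
  Symmetry of second derivatives at the boundary point \<open>\<epsilon> = 0\<close>, where only one-sided
  differentiation in \<open>\<epsilon>\<close> is possible. With \<open>G = \<partial>\<Phi> / \<partial>\<epsilon>\<close>, the increment
  \<open>\<Phi> (\<epsilon>, z) - \<Phi> (0, z)\<close> is the integral of \<open>G\<close> over \<open>[0, \<epsilon>]\<close>. Differentiating under the
  integral in the direction \<open>v\<close>, which is interior, expresses the increment of
  \<open>\<partial>\<Phi> / \<partial>v\<close> as an integral of the continuous function \<open>\<partial>G / \<partial>v\<close>, whose one-sided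
  derivative at \<open>0\<close> is \<open>\<partial>G / \<partial>v\<close> there.
\<close>
lemma mixed_derivative_at_boundary:
  fixes \<Phi> :: "real \<times> 'a::real_normed_vector \<Rightarrow> real"
  assumes C2: "Ck_on 2 \<Phi> ({0..<e} \<times> W)" and W: "open W" "z \<in> W" and e: "0 < e"
  shows "((\<lambda>\<epsilon>. frechet_derivative \<Phi> (at (\<epsilon>, z) within {0..<e} \<times> W) (0, v)) has_real_derivative
      frechet_derivative (\<lambda>y. frechet_derivative \<Phi> (at y within {0..<e} \<times> W) (1, 0))
        (at (0, z) within {0..<e} \<times> W) (0, v)) (at_right 0)"
proof -
  define S where "S = {0..<e} \<times> W"
  define D where "D y = frechet_derivative \<Phi> (at y within S)" for y
  define G where "G y = D y (1, 0)" for y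
  define DG where "DG y = frechet_derivative G (at y within S)" for y
  have C2': "Ck_on (Suc (Suc 0)) \<Phi> S"
    using C2 unfolding numeral_2_eq_2 S_def .
  have D: "(\<Phi> has_derivative D y) (at y within S)" if "y \<in> S" for y
    using Ck_on_SucD(1)[OF C2' that] unfolding D_def .
  have G_C1: "Ck_on (Suc 0) G S"
    using Ck_on_SucD(2)[OF C2'] unfolding G_def D_def .
  have DG: "(G has_derivative DG y) (at y within S)" if "y \<in> S" for y
    using Ck_on_SucD(1)[OF G_C1 that] unfolding DG_def .
  have DG_cont: "continuous_on S (\<lambda>y. DG y (0, v))"
    using Ck_on_SucD(2)[OF G_C1] unfolding DG_def Ck_on.simps(1) .
  have "open ((\<lambda>s. z + s *\<^sub>R v) -` W)"
    by (rule open_vimage[OF W(1)]) (intro continuous_intros)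
  moreover have "0 \<in> (\<lambda>s. z + s *\<^sub>R v) -` W"
    using W by simp
  ultimately obtain \<delta> where \<delta>: "0 < \<delta>" "ball 0 \<delta> \<subseteq> (\<lambda>s. z + s *\<^sub>R v) -` W"
    using open_contains_ball by blast
  let ?B = "ball (0::real) \<delta>"
  have line: "z + s *\<^sub>R v \<in> W" if "s \<in> ?B" for s
    using \<delta>(2) that by auto
  \<comment> \<open>A closed parameter interval inside \<open>[0, e)\<close>, for integration.\<close>
  define a where "a = e / 2"
  have a: "0 < a" "a < e"
    using e by (auto simp: a_def)
  have increment: "integral {0..\<epsilon>} (\<lambda>r. DG (r, z) (0, v)) = D (\<epsilon>, z) (0, v) - D (0, z) (0, v)"
    if \<epsilon>: "\<epsilon> \<in> {0..a}" for \<epsilon>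
  proof -
    have S: "(r, z + s *\<^sub>R v) \<in> S" if "r \<in> {0..\<epsilon>}" "s \<in> ?B" for r s
      using that \<epsilon> a line by (auto simp: S_def)
    have G_int: "((\<lambda>r. G (r, z + s *\<^sub>R v)) has_integral
        \<Phi> (\<epsilon>, z + s *\<^sub>R v) - \<Phi> (0, z + s *\<^sub>R v)) {0..\<epsilon>}" if s: "s \<in> ?B" for s
    proof (rule fundamental_theorem_of_calculus)
      fix r assume r: "r \<in> {0..\<epsilon>}"
      have "((\<lambda>r. \<Phi> (r, z + s *\<^sub>R v)) has_vector_derivative G (r, z + s *\<^sub>R v)) (at r within {0..<e})"
        unfolding G_def
        by (rule parameter_has_vector_derivative[where W = W])
          (use D[OF S[OF r s]] line[OF s] in \<open>auto simp: S_def\<close>)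
      then show "((\<lambda>r. \<Phi> (r, z + s *\<^sub>R v)) has_vector_derivative G (r, z + s *\<^sub>R v))
          (at r within {0..\<epsilon>})"
        by (rule has_vector_derivative_within_subset) (use \<epsilon> a in auto)
    qed (use \<epsilon> in auto)
    have "((\<lambda>s. integral (cbox 0 \<epsilon>) (\<lambda>r. G (r, z + s *\<^sub>R v))) has_vector_derivative
        integral (cbox 0 \<epsilon>) (\<lambda>r. DG (r, z + 0 *\<^sub>R v) (0, v))) (at 0 within ?B)"
    proof (rule leibniz_rule_vector_derivative[where fx = "\<lambda>s r. DG (r, z + s *\<^sub>R v) (0, v)"])
      fix s r assume sr: "s \<in> ?B" "r \<in> cbox 0 \<epsilon>"
      have y: "(r, z + s *\<^sub>R v) \<in> S"
        using S[of r s] sr by simp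
      show "((\<lambda>s. G (r, z + s *\<^sub>R v)) has_vector_derivative DG (r, z + s *\<^sub>R v) (0, v)) (at s within ?B)"
        by (rule line_has_vector_derivative, rule slice_has_derivative[where I = "{0..<e}" and W = W])
          (use DG[OF y] y W(1) in \<open>auto simp: S_def\<close>)
    next
      show "(\<lambda>r. G (r, z + s *\<^sub>R v)) integrable_on cbox 0 \<epsilon>" if "s \<in> ?B" for s
        using G_int[OF that] by (auto simp: integrable_on_def)
      show "continuous_on (?B \<times> cbox 0 \<epsilon>) (\<lambda>(s, r). DG (r, z + s *\<^sub>R v) (0, v))"
        unfolding case_prod_beta
        by (rule continuous_on_compose2[OF DG_cont]) (use S in \<open>auto intro!: continuous_intros\<close>)
    qed (use \<delta> in auto)
    then have "((\<lambda>s. integral {0..\<epsilon>} (\<lambda>r. G (r, z + s *\<^sub>R v))) has_vector_derivative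
        integral {0..\<epsilon>} (\<lambda>r. DG (r, z) (0, v))) (at 0)"
      using \<delta> by (simp add: at_within_open[of 0 ?B])
    then have I: "((\<lambda>s. \<Phi> (\<epsilon>, z + s *\<^sub>R v) - \<Phi> (0, z + s *\<^sub>R v)) has_vector_derivative
        integral {0..\<epsilon>} (\<lambda>r. DG (r, z) (0, v))) (at 0)"
      by (rule has_vector_derivative_transform_within_open[where S = ?B])
        (use \<delta> G_int in \<open>auto simp: integral_unique\<close>)
    have \<Phi>': "((\<lambda>s. \<Phi> (r, z + s *\<^sub>R v)) has_vector_derivative D (r, z) (0, v)) (at 0)"
      if "r \<in> {0..\<epsilon>}" for r
    proof (rule line_has_vector_derivative)
      have "((\<lambda>w. \<Phi> (r, w)) has_derivative (\<lambda>w. D (r, z) (0, w))) (at z)"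
        by (rule slice_has_derivative[where I = "{0..<e}" and W = W])
          (use D S[OF that, of 0] \<delta> W that \<epsilon> a in \<open>auto simp: S_def\<close>)
      then show "((\<lambda>w. \<Phi> (r, w)) has_derivative (\<lambda>w. D (r, z) (0, w))) (at (z + 0 *\<^sub>R v))"
        by simp
    qed
    have "((\<lambda>s. \<Phi> (\<epsilon>, z + s *\<^sub>R v) - \<Phi> (0, z + s *\<^sub>R v)) has_vector_derivative
        D (\<epsilon>, z) (0, v) - D (0, z) (0, v)) (at 0)"
      by (intro has_vector_derivative_diff \<Phi>') (use \<epsilon> in auto)
    with I show ?thesis
      by (rule vector_derivative_unique_at)
  qed
  have "continuous_on {0..a} (\<lambda>r. DG (r, z) (0, v))"
    by (rule continuous_on_compose2[OF DG_cont]) (use a W in \<open>auto simp: S_def intro!: continuous_intros\<close>)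
  then have "((\<lambda>\<epsilon>. integral {0..\<epsilon>} (\<lambda>r. DG (r, z) (0, v))) has_real_derivative DG (0, z) (0, v))
      (at 0 within {0..a})"
    by (rule integral_has_real_derivative) (use a in auto)
  then have "((\<lambda>\<epsilon>. integral {0..\<epsilon>} (\<lambda>r. DG (r, z) (0, v)) + D (0, z) (0, v)) has_real_derivative
      DG (0, z) (0, v) + 0) (at 0 within {0..a})"
    by (intro DERIV_add DERIV_const)
  then have "((\<lambda>\<epsilon>. D (\<epsilon>, z) (0, v)) has_real_derivative DG (0, z) (0, v)) (at 0 within {0..a})"
    unfolding add_0_right
    by (rule has_field_derivative_transform_within[where d = a]) (use increment a in auto)
  then have "((\<lambda>\<epsilon>. D (\<epsilon>, z) (0, v)) has_real_derivative DG (0, z) (0, v)) (at_right 0)"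
    unfolding at_within_Icc_at_right[OF a(1)] .
  then show ?thesis
    unfolding DG_def G_def D_def S_def .
qed


section \<open>The first-order coefficient of a family of first integrals\<close>

lemma at_right_zero_within:
  assumes "(0::real) < e"
  shows "at 0 within {0..<e} = at_right 0"
  by (rule at_within_nhd[of 0 "{..<e}"]) (use assms in auto)

text \<open>
  The derivative in the parameter at \<open>0\<close>, written as a limit of difference quotients so that its
  value at a point involves the family at that point only. It therefore makes sense on the phase
  space over the circle, and commutes with lifting to the covering space; periodicity of the lift
  is then automatic.
\<close>
definition first_order_coeff :: "(real \<Rightarrow> 'a \<Rightarrow> real) \<Rightarrow> 'a \<Rightarrow> real" where
  "first_order_coeff F z = Lim (at_right 0) (\<lambda>\<epsilon>. (F \<epsilon> z - F 0 z) / \<epsilon>)"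

text \<open>
  The order-\<open>\<epsilon>\<close> part of \<open>DF\<^sub>\<epsilon> (X + \<epsilon> Y) = 0\<close>. Put \<open>A \<epsilon> = DF\<^sub>\<epsilon> X\<close> and
  \<open>B \<epsilon> = DF\<^sub>\<epsilon> Y\<close> at \<open>z\<close>. For \<open>\<epsilon> > 0\<close> the identity says \<open>A \<epsilon> = - \<epsilon> B \<epsilon>\<close>; by continuity \<open>A 0 = 0\<close>,
  so \<open>A\<close> has one-sided derivative \<open>- B 0\<close> at \<open>0\<close>. By \<open>mixed_derivative_at_boundary\<close> the same
  derivative is that of the first-order coefficient in the direction \<open>X\<close>.
\<close>
lemma first_order_coeff_derivative:
  fixes F :: "real \<Rightarrow> 'a::real_normed_vector \<Rightarrow> real"
  assumes C2: "Ck_on 2 (\<lambda>(\<epsilon>, z). F \<epsilon> z) ({0..<e} \<times> W)" and W: "open W" "z \<in> W" and e: "0 < e"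
    and integral: "\<And>\<epsilon>. \<epsilon> \<in> {0<..<e} \<Longrightarrow> first_integral_on (\<lambda>z. X z + \<epsilon> *\<^sub>R Y z) W (F \<epsilon>)"
  shows "first_order_coeff F differentiable (at z)"
    and "frechet_derivative (first_order_coeff F) (at z) (X z) = - frechet_derivative (F 0) (at z) (Y z)"
proof -
  define \<Phi> where "\<Phi> = (\<lambda>(\<epsilon>, z). F \<epsilon> z)"
  define S where "S = {0..<e} \<times> W"
  define D where "D y = frechet_derivative \<Phi> (at y within S)" for y
  define G where "G y = D y (1, 0)" for y
  define DG where "DG y = frechet_derivative G (at y within S)" for y
  have C2': "Ck_on (Suc (Suc 0)) \<Phi> S"
    using C2 unfolding numeral_2_eq_2 \<Phi>_def S_def .
  have S: "(\<epsilon>, w) \<in> S" if "\<epsilon> \<in> {0..<e}" "w \<in> W" for \<epsilon> w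
    using that by (simp add: S_def)
  have D: "(\<Phi> has_derivative D (\<epsilon>, w)) (at (\<epsilon>, w) within {0..<e} \<times> W)"
    if "\<epsilon> \<in> {0..<e}" "w \<in> W" for \<epsilon> w
    using Ck_on_SucD(1)[OF C2' S[OF that]] unfolding D_def S_def .
  have D_C1: "Ck_on (Suc 0) (\<lambda>y. D y v) S" for v
    using Ck_on_SucD(2)[OF C2'] unfolding D_def .
  have zero: "0 \<in> {0..<e}"
    using e by simp
  have F': "(F \<epsilon> has_derivative (\<lambda>w. D (\<epsilon>, z) (0, w))) (at z)" if "\<epsilon> \<in> {0..<e}" for \<epsilon>
    using slice_has_derivative[OF D[OF that W(2)] W that] by (simp add: \<Phi>_def)
  note at_zero = at_right_zero_within[OF e]
  have coeff: "first_order_coeff F w = G (0, w)" if "w \<in> W" for w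
  proof -
    have "((\<lambda>\<epsilon>. F \<epsilon> w) has_vector_derivative G (0, w)) (at_right 0)"
      using parameter_has_vector_derivative[OF D[OF zero that] that]
      by (simp add: G_def \<Phi>_def at_zero)
    then have "((\<lambda>\<epsilon>. (F \<epsilon> w - F 0 w) / \<epsilon>) \<longlongrightarrow> G (0, w)) (at_right 0)"
      by (simp add: has_field_derivative_iff flip: has_real_derivative_iff_has_vector_derivative)
    then show ?thesis
      unfolding first_order_coeff_def by (intro tendsto_Lim) auto
  qed
  have "(G has_derivative DG (0, z)) (at (0, z) within {0..<e} \<times> W)"
    using Ck_on_SucD(1)[OF D_C1 S[OF zero W(2)]] unfolding DG_def G_def S_def .
  from slice_has_derivative[OF this W zero]
  have "((\<lambda>w. G (0, w)) has_derivative (\<lambda>w. DG (0, z) (0, w))) (at z)" .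
  then have coeff': "(first_order_coeff F has_derivative (\<lambda>w. DG (0, z) (0, w))) (at z)"
    by (rule has_derivative_transform_within_open[OF _ W]) (simp add: coeff)
  then show "first_order_coeff F differentiable (at z)"
    by (auto simp: differentiable_def)
  define A where "A \<epsilon> = D (\<epsilon>, z) (0, X z)" for \<epsilon>
  define B where "B \<epsilon> = D (\<epsilon>, z) (0, Y z)" for \<epsilon>
  have A_eq: "A \<epsilon> = - \<epsilon> * B \<epsilon>" if \<epsilon>: "\<epsilon> \<in> {0<..<e}" for \<epsilon>
  proof -
    have "\<epsilon> \<in> {0..<e}"
      using \<epsilon> by simp
    note F' = F'[OF this]
    have "0 = frechet_derivative (F \<epsilon>) (at z) (X z + \<epsilon> *\<^sub>R Y z)"
      using integral[OF \<epsilon>] W by (simp add: first_integral_on_def)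
    also have "\<dots> = D (\<epsilon>, z) (0, X z + \<epsilon> *\<^sub>R Y z)"
      using fun_cong[OF frechet_derivative_at[OF F']] by simp
    also have "\<dots> = A \<epsilon> + \<epsilon> * B \<epsilon>"
      using linear_add[OF has_derivative_linear[OF F'], of "X z" "\<epsilon> *\<^sub>R Y z"]
        linear_scale[OF has_derivative_linear[OF F'], of \<epsilon> "Y z"]
      by (simp add: A_def B_def)
    finally show ?thesis
      by simp
  qed
  have right: "\<forall>\<^sub>F \<epsilon> in at_right 0. \<epsilon> \<in> {0<..<e}"
    using e by (auto simp: eventually_at_right)
  have A_deriv: "(A has_real_derivative DG (0, z) (0, X z)) (at_right 0)"
    using mixed_derivative_at_boundary[OF C2 W e, of "X z"]
    unfolding A_def DG_def G_def D_def S_def \<Phi>_def .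
  have B_tendsto: "(B \<longlongrightarrow> B 0) (at_right 0)"
  proof -
    have "continuous_on {0..<e} B"
      unfolding B_def
      by (rule continuous_on_compose2[OF Ck_on_Suc_continuous_on[OF D_C1]])
        (use W in \<open>auto simp: S_def intro!: continuous_intros\<close>)
    then have "(B \<longlongrightarrow> B 0) (at 0 within {0..<e})"
      using zero unfolding continuous_on_def by blast
    then show ?thesis
      unfolding at_zero .
  qed
  have "(A \<longlongrightarrow> A 0) (at_right 0)"
    using DERIV_continuous[OF A_deriv] by (simp add: continuous_within)
  moreover have "((\<lambda>\<epsilon>. - \<epsilon> * B \<epsilon>) \<longlongrightarrow> - 0 * B 0) (at_right 0)"
    by (intro tendsto_intros B_tendsto)
  then have "(A \<longlongrightarrow> - 0 * B 0) (at_right 0)"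
    by (rule Lim_transform_eventually) (auto intro!: eventually_mono[OF right] simp: A_eq)
  ultimately have A0: "A 0 = 0"
    using tendsto_unique[OF trivial_limit_at_right_real] by force
  have "((\<lambda>\<epsilon>. A \<epsilon> / \<epsilon>) \<longlongrightarrow> DG (0, z) (0, X z)) (at_right 0)"
    using A_deriv by (simp add: has_field_derivative_iff A0)
  moreover have "((\<lambda>\<epsilon>. A \<epsilon> / \<epsilon>) \<longlongrightarrow> - B 0) (at_right 0)"
    by (rule Lim_transform_eventually[where f = "\<lambda>\<epsilon>. - B \<epsilon>"])
      (auto intro!: tendsto_intros B_tendsto eventually_mono[OF right] simp: A_eq)
  ultimately have "DG (0, z) (0, X z) = - B 0"
    using tendsto_unique[OF trivial_limit_at_right_real] by blast
  then show "frechet_derivative (first_order_coeff F) (at z) (X z)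
      = - frechet_derivative (F 0) (at z) (Y z)"
    using fun_cong[OF frechet_derivative_at[OF coeff']]
      fun_cong[OF frechet_derivative_at[OF F'[OF zero]]]
    by (simp add: B_def)
qed

section \<open>The Melnikov integrand as a derivative\<close>

lemma grad_inner:
  assumes "H differentiable (at x)"
  shows "grad H x \<bullet> v = frechet_derivative H (at x) v"
proof -
  have lin: "linear (frechet_derivative H (at x))"
    using assms by (rule linear_frechet_derivative)
  have "frechet_derivative H (at x) v = frechet_derivative H (at x) (\<Sum>i\<in>UNIV. v $ i *\<^sub>R axis i 1)"
    by (simp add: basis_expansion flip: scalar_mult_eq_scaleR)
  also have "\<dots> = grad H x \<bullet> v"
    by (simp add: linear_sum[OF lin] linear_scale[OF lin] grad_def inner_vec_def mult.commute)
  finally show ?thesis ..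
qed

lemma ham_field_eq_0_iff: "ham_field H x = 0 \<longleftrightarrow> grad H x = 0"
  by (auto simp: ham_field_def J2_def vec_eq_iff forall_2 matrix_vector_mult_def sum_2)

lemma limit_parameter_eq:
  fixes F :: "real \<Rightarrow> 'a::real_normed_vector \<Rightarrow> real"
  assumes cont: "continuous_on ({0..<e} \<times> W) (\<lambda>(\<epsilon>, z). F \<epsilon> z)" and z: "z \<in> W" and e: "0 < e"
    and bigo: "(\<lambda>\<epsilon>. F \<epsilon> z - c) \<in> O[at_right 0](\<lambda>\<epsilon>. \<epsilon>)"
  shows "F 0 z = c"
proof -
  have "continuous_on {0..<e} (\<lambda>\<epsilon>. F \<epsilon> z)"
  proof -
    have "continuous_on {0..<e} (\<lambda>\<epsilon>. (\<epsilon>, z))"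
      by (intro continuous_on_Pair continuous_on_id continuous_on_const)
    from continuous_on_compose2[OF cont this] show ?thesis
      using z by auto
  qed
  then have "((\<lambda>\<epsilon>. F \<epsilon> z) \<longlongrightarrow> F 0 z) (at 0 within {0..<e})"
    using e unfolding continuous_on_def by auto
  then have "((\<lambda>\<epsilon>. F \<epsilon> z) \<longlongrightarrow> F 0 z) (at_right 0)"
    unfolding at_right_zero_within[OF e] .
  moreover obtain C where C: "\<forall>\<^sub>F \<epsilon> in at_right 0. norm (F \<epsilon> z - c) \<le> C * norm \<epsilon>"
    using bigo by (rule landau_o.bigE)
  have "((\<lambda>\<epsilon>. F \<epsilon> z) \<longlongrightarrow> c) (at_right 0)"
    by (rule LIM_zero_cancel, rule Lim_null_comparison[OF C])
      (auto intro!: tendsto_eq_intros)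
  ultimately show ?thesis
    using tendsto_unique[OF trivial_limit_at_right_real] by blast
qed

lemma pert_field_affine:
  "pert_field H g \<epsilon> = (\<lambda>z. (ham_field H (fst z), 1) + \<epsilon> *\<^sub>R (g (fst z) (snd z), 0))"
  unfolding pert_field_def by (rule ext) (simp add: case_prod_beta)

text \<open>
  The curve \<open>s \<mapsto> (y s, s + \<tau>)\<close> is an integral curve of the unperturbed field, so this is
  \<open>first_order_coeff_derivative\<close> and the chain rule; \<open>F 0 = H\<close> turns \<open>DF\<^sub>0 Y\<close> into
  \<open>DH \<bullet> g\<close>. The integrand thus arises as a pointwise derivative, the form in which
  \<open>has_integral_UNIV_of_limits\<close> integrates it.
\<close>
lemma first_order_coeff_along_unperturbed_solution:
  assumes H: "H differentiable (at (y s))"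
    and C2: "Ck_on 2 (\<lambda>(\<epsilon>, z). F \<epsilon> z) ({0..<e} \<times> W)" and W: "open W" "(y s, s + \<tau>) \<in> W" and e: "0 < e"
    and integral: "\<And>\<epsilon>. \<epsilon> \<in> {0<..<e} \<Longrightarrow> first_integral_on (pert_field H g \<epsilon>) W (F \<epsilon>)"
    and F0: "\<And>x t. (x, t) \<in> W \<Longrightarrow> F 0 (x, t) = H x"
    and y: "(y has_vector_derivative ham_field H (y s)) (at s)"
  shows "((\<lambda>s. first_order_coeff F (y s, s + \<tau>)) has_vector_derivative
      - melnikov_integrand H g y \<tau> s) (at s)"
proof -
  define z where "z = (y s, s + \<tau>)"
  define X :: "(real^2) \<times> real \<Rightarrow> (real^2) \<times> real" where "X z = (ham_field H (fst z), 1)" for z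
  define Y :: "(real^2) \<times> real \<Rightarrow> (real^2) \<times> real" where "Y z = (g (fst z) (snd z), 0)" for z
  have z: "z \<in> W"
    using W(2) by (simp add: z_def)
  have "pert_field H g \<epsilon> = (\<lambda>z. X z + \<epsilon> *\<^sub>R Y z)" for \<epsilon>
    unfolding X_def Y_def by (rule pert_field_affine)
  note integral' = integral[unfolded this]
  have coeff: "first_order_coeff F differentiable (at z)"
    "frechet_derivative (first_order_coeff F) (at z) (X z) = - frechet_derivative (F 0) (at z) (Y z)"
    by (rule first_order_coeff_derivative[OF C2 W(1) z e integral'], assumption)+
  have "(H has_derivative frechet_derivative H (at (fst z))) (at (fst z))"
    using H by (simp add: z_def frechet_derivative_works)
  then have "((\<lambda>w. H (fst w)) has_derivative (\<lambda>w. frechet_derivative H (at (fst z)) (fst w))) (at z)"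
    by (rule has_derivative_compose[OF has_derivative_fst[OF has_derivative_ident]])
  then have "(F 0 has_derivative (\<lambda>w. frechet_derivative H (at (fst z)) (fst w))) (at z)"
    by (rule has_derivative_transform_within_open[OF _ W(1) z]) (auto simp: F0)
  then have "frechet_derivative (F 0) (at z) (Y z) = frechet_derivative H (at (fst z)) (fst (Y z))"
    by (rule fun_cong[OF frechet_derivative_at, symmetric])
  also have "\<dots> = melnikov_integrand H g y \<tau> s"
    unfolding melnikov_integrand_def grad_inner[OF H] Y_def z_def fst_conv snd_conv ..
  finally have rate: "frechet_derivative (F 0) (at z) (Y z) = melnikov_integrand H g y \<tau> s" .
  have "((\<lambda>s. (y s, s + \<tau>)) has_vector_derivative X z) (at s)"
    unfolding X_def z_def fst_conv
    using has_vector_derivative_Pair[OF y has_vector_derivative_add[OF has_vector_derivative_id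
          has_vector_derivative_const], of \<tau>] by simp
  moreover have "(first_order_coeff F has_derivative frechet_derivative (first_order_coeff F) (at z))
      (at (y s, s + \<tau>))"
    using coeff(1) by (simp add: frechet_derivative_works z_def)
  ultimately have "((first_order_coeff F \<circ> (\<lambda>s. (y s, s + \<tau>))) has_vector_derivative
      frechet_derivative (first_order_coeff F) (at z) (X z)) (at s)"
    by (rule vector_derivative_diff_chain_within[OF _ has_derivative_at_withinI])
  then show ?thesis
    unfolding o_def coeff(2) rate .
qed

text \<open>
  The Henstock-Kurzweil integral over the line is by definition the limit of the integrals over
  growing boxes, so the integral of a pointwise derivative converges as soon as the antiderivative
  has limits at both ends.
\<close>
lemma has_integral_UNIV_of_limits:
  fixes f :: "real \<Rightarrow> 'a::banach"
  assumes f': "\<And>s. (f has_vector_derivative f' s) (at s)"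
    and top: "(f \<longlongrightarrow> l) at_top" and bot: "(f \<longlongrightarrow> m) at_bot"
  shows "(f' has_integral (l - m)) UNIV"
proof -
  have no_box: "\<nexists>a b. (UNIV :: real set) = cbox a b"
    by (metis bounded_cbox not_bounded_UNIV)
  have "\<exists>B>0. \<forall>a b. ball 0 B \<subseteq> cbox a b \<longrightarrow>
      (\<exists>z. (f' has_integral z) (cbox a b) \<and> norm (z - (l - m)) < e)" if e: "0 < e" for e
  proof -
    obtain N where N: "\<And>s. N \<le> s \<Longrightarrow> dist (f s) l < e / 2"
      using tendstoD[OF top, of "e / 2"] e by (auto simp: eventually_at_top_linorder)
    obtain M where M: "\<And>s. s \<le> M \<Longrightarrow> dist (f s) m < e / 2"
      using tendstoD[OF bot, of "e / 2"] e by (auto simp: eventually_at_bot_linorder)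
    define B where "B = \<bar>N\<bar> + \<bar>M\<bar> + 1"
    have "\<exists>z. (f' has_integral z) (cbox a b) \<and> norm (z - (l - m)) < e"
      if sub: "ball 0 B \<subseteq> cbox a b" for a b
    proof (intro exI conjI)
      have "N \<in> ball 0 B" "M \<in> ball 0 B"
        by (auto simp: B_def)
      with sub have ab: "a \<le> M" "N \<le> b" "a \<le> b"
        by auto
      show "(f' has_integral (f b - f a)) (cbox a b)"
        using fundamental_theorem_of_calculus[of a b f f'] ab f'
        by (auto intro: has_vector_derivative_at_within)
      have "norm (f b - f a - (l - m)) = norm ((f b - l) - (f a - m))"
        by (simp add: algebra_simps)
      also have "\<dots> \<le> norm (f b - l) + norm (f a - m)"
        by (rule norm_triangle_ineq4)
      also have "\<dots> < e"
        using N[OF ab(2)] M[OF ab(1)] by (simp add: dist_norm)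
      finally show "norm (f b - f a - (l - m)) < e" .
    qed
    then show ?thesis
      by (intro exI[of _ B]) (auto simp: B_def)
  qed
  then show ?thesis
    by (subst has_integral_alt) (simp add: no_box)
qed

section \<open>The covering of the phase space\<close>

lemma coset_mod_eq_iff:
  "coset_mod T s = coset_mod T t \<longleftrightarrow> (\<exists>k::int. s = t + of_int k * T)"
proof
  have "s \<in> coset_mod T s"
    unfolding coset_mod_def by (auto intro: exI[of _ 0])
  then show "\<exists>k::int. s = t + of_int k * T" if "coset_mod T s = coset_mod T t"
    using that by (auto simp: coset_mod_def)
next
  assume "\<exists>k::int. s = t + of_int k * T"
  then obtain k :: int where k: "s = t + of_int k * T" ..
  have "(\<exists>j::int. r = s + of_int j * T) \<longleftrightarrow> (\<exists>j::int. r = t + of_int j * T)" for r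
  proof
    assume "\<exists>j::int. r = s + of_int j * T"
    then obtain j :: int where "r = s + of_int j * T" ..
    then have "r = t + of_int (j + k) * T"
      using k by (simp add: algebra_simps)
    then show "\<exists>j::int. r = t + of_int j * T" ..
  next
    assume "\<exists>j::int. r = t + of_int j * T"
    then obtain j :: int where "r = t + of_int j * T" ..
    then have "r = s + of_int (j - k) * T"
      using k by (simp add: algebra_simps)
    then show "\<exists>j::int. r = s + of_int j * T" ..
  qed
  then show "coset_mod T s = coset_mod T t"
    by (simp add: coset_mod_def)
qed

lemma coset_mod_fundamental_domain:
  assumes "0 < T"
  obtains s where "s \<in> {0..T}" "coset_mod T s = coset_mod T t"
proof
  let ?k = "\<lfloor>t / T\<rfloor>"
  have "of_int ?k \<le> t / T" "t / T \<le> of_int ?k + 1"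
    by linarith+
  then have "of_int ?k * T \<le> t" "t \<le> (of_int ?k + 1) * T"
    using assms by (simp_all only: le_divide_eq divide_le_eq if_True)
  then show "t - of_int ?k * T \<in> {0..T}"
    by (simp add: algebra_simps)
  show "coset_mod T (t - of_int ?k * T) = coset_mod T t"
    unfolding coset_mod_eq_iff by (rule exI[of _ "- ?k"]) simp
qed

lemma open_lift_set:
  assumes "openin (phase_space T) U"
  shows "open (lift_set T U)"
proof -
  have "continuous_map (prod_topology euclidean euclidean) (phase_space T) (\<lambda>(x, t). (x, coset_mod T t))"
    unfolding continuous_map_prod_top
    using quotient_imp_continuous_map[OF quotient_map_coset_mod] by auto
  from openin_continuous_map_preimage[OF this assms]
  show ?thesis
    by (simp add: lift_set_def case_prod_beta')
qed

lemma openin_circle_image: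
  assumes "open A"
  shows "openin (circle T) (coset_mod T ` A)"
proof -
  have "coset_mod T -` coset_mod T ` A = (\<Union>k::int. (\<lambda>s. s - of_int k * T) -` A)"
  proof (intro set_eqI iffI)
    fix s assume "s \<in> coset_mod T -` coset_mod T ` A"
    then obtain a where a: "a \<in> A" "coset_mod T s = coset_mod T a"
      by auto
    from a(2) obtain k :: int where "s = a + of_int k * T"
      unfolding coset_mod_eq_iff ..
    with a(1) have "s \<in> (\<lambda>s. s - of_int k * T) -` A"
      by simp
    then show "s \<in> (\<Union>k::int. (\<lambda>s. s - of_int k * T) -` A)"
      by (rule UN_I[OF UNIV_I])
  next
    fix s assume "s \<in> (\<Union>k::int. (\<lambda>s. s - of_int k * T) -` A)"
    then obtain k :: int where k: "s - of_int k * T \<in> A"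
      by auto
    have "coset_mod T s = coset_mod T (s - of_int k * T)"
      unfolding coset_mod_eq_iff by (rule exI[of _ k]) simp
    with k show "s \<in> coset_mod T -` coset_mod T ` A"
      by auto
  qed
  moreover have "open ((\<lambda>s. s - of_int k * T) -` A)" for k :: int
    by (rule open_vimage[OF assms]) (intro continuous_intros)
  ultimately show ?thesis
    by (auto simp: openin_circle)
qed

text \<open>The tube lemma over the compact circle, read on the covering space.\<close>
lemma ball_times_circle_subset:
  assumes T: "0 < T" and N: "open (lift_set T N)" and p: "\<And>t. (p, t) \<in> lift_set T N"
  obtains r where "0 < r" "\<And>x t. x \<in> ball p r \<Longrightarrow> (x, t) \<in> lift_set T N"
proof -
  obtain X where X: "p \<in> X" "open X" "X \<times> {0..T} \<subseteq> lift_set T N"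
    using Elementary_Topology.tube_lemma[OF compact_Icc N, of p 0 T] p by blast
  obtain r where r: "0 < r" "ball p r \<subseteq> X"
    using X(1,2) open_contains_ball by blast
  have "(x, t) \<in> lift_set T N" if x: "x \<in> ball p r" for x t
  proof -
    obtain s where s: "s \<in> {0..T}" "coset_mod T s = coset_mod T t"
      using coset_mod_fundamental_domain[OF T] .
    then have "(x, s) \<in> lift_set T N"
      using subsetD[OF X(3), of "(x, s)"] subsetD[OF r(2) x] by simp
    then show ?thesis
      using s(2) by (simp add: lift_set_def)
  qed
  with r(1) show thesis
    by (rule that)
qed

text \<open>
  The times \<open>t + n T\<close> all represent the phase of \<open>t\<close>, while the orbit at these times tends to \<open>p\<close>.
\<close>
lemma limit_circle_in_closure:
  assumes T: "0 < T" and q: "(q \<longlongrightarrow> p) at_top"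
  shows "(p, coset_mod T t) \<in> phase_space T closure_of orbit_curve T q \<tau>0"
  unfolding in_closure_of
proof (intro conjI allI impI)
  show "(p, coset_mod T t) \<in> topspace (phase_space T)"
    by (simp add: topspace_circle)
  fix N assume N: "(p, coset_mod T t) \<in> N \<and> openin (phase_space T) N"
  have "filterlim (\<lambda>n. t - \<tau>0 + real n * T) at_top sequentially"
    using T
    by (intro filterlim_tendsto_add_at_top[OF tendsto_const]
        filterlim_at_top_mult_tendsto_pos[OF tendsto_const] filterlim_real_sequentially)
  then have "(\<lambda>n. q (t - \<tau>0 + real n * T)) \<longlonglongrightarrow> p"
    using filterlim_compose[OF q] by blast
  then have "(\<lambda>n. (q (t - \<tau>0 + real n * T), t)) \<longlonglongrightarrow> (p, t)"
    by (intro tendsto_intros)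
  moreover have "open (lift_set T N)" "(p, t) \<in> lift_set T N"
    using N open_lift_set by (auto simp: lift_set_def)
  ultimately have "\<forall>\<^sub>F n in sequentially. (q (t - \<tau>0 + real n * T), t) \<in> lift_set T N"
    by (rule topological_tendstoD)
  then obtain n where n: "(q (t - \<tau>0 + real n * T), t) \<in> lift_set T N"
    by (auto simp: eventually_sequentially)
  have "coset_mod T (t + real n * T) = coset_mod T t"
    unfolding coset_mod_eq_iff by (rule exI[of _ "int n"]) simp
  then have "(q (t - \<tau>0 + real n * T), coset_mod T t) \<in> orbit_curve T q \<tau>0"
    unfolding orbit_curve_def by (intro range_eqI[of _ _ "t + real n * T"]) (simp add: algebra_simps)
  with n show "\<exists>y. y \<in> orbit_curve T q \<tau>0 \<and> y \<in> N"
    by (auto simp: lift_set_def)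
qed

text \<open>
  By compactness of the circle, closeness of \<open>f\<close> to \<open>c\<close> near \<open>{p} \<times> \<real>/T\<int>\<close> is uniform in the
  phase, so convergence of the first component to \<open>p\<close> is enough, however the phase \<open>\<phi>\<close> moves.
\<close>
lemma tendsto_of_constant_on_limit_circle:
  fixes f :: "(real^2) \<times> real set \<Rightarrow> real"
  assumes T: "0 < T" and U: "open (lift_set T U)" and f: "continuous_on (lift_set T U) (lift_fun T f)"
    and p: "\<And>t. (p, t) \<in> lift_set T U" "\<And>t. lift_fun T f (p, t) = c"
    and q: "(q \<longlongrightarrow> p) A"
  shows "((\<lambda>s. lift_fun T f (q s, \<phi> s)) \<longlongrightarrow> c) A"
proof (rule tendstoI)
  fix e :: real assume e: "0 < e"
  define N where "N = {w \<in> U. f w \<in> ball c e}"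
  have "lift_set T N = lift_set T U \<inter> lift_fun T f -` ball c e"
    by (auto simp: N_def lift_set_def lift_fun_def)
  then have N: "open (lift_set T N)"
    using continuous_open_preimage[OF f U open_ball] by simp
  have "(p, t) \<in> lift_set T N" for t
    using p[of t] e by (simp add: N_def lift_set_def lift_fun_def)
  then obtain r where r: "0 < r" "\<And>x t. x \<in> ball p r \<Longrightarrow> (x, t) \<in> lift_set T N"
    using ball_times_circle_subset[OF T N] by blast
  have "\<forall>\<^sub>F s in A. q s \<in> ball p r"
    using tendstoD[OF q r(1)] by (simp add: dist_commute)
  then show "\<forall>\<^sub>F s in A. dist (lift_fun T f (q s, \<phi> s)) c < e"
  proof (rule eventually_mono)
    fix s assume "q s \<in> ball p r"
    then have "(q s, \<phi> s) \<in> lift_set T N"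
      by (rule r(2))
    then show "dist (lift_fun T f (q s, \<phi> s)) c < e"
      by (simp add: N_def lift_set_def lift_fun_def dist_commute)
  qed
qed

text \<open>
  For large \<open>\<bar>s\<bar>\<close> the point \<open>q s\<close> is so close to \<open>p\<close> that every phase is admissible; the remaining
  arc of the curve is compact and thus has a uniform distance from the complement.
\<close>
lemma nearby_phases_stay_in_nbhd:
  assumes T: "0 < T" and U: "open (lift_set T U)"
    and q: "continuous_on UNIV q" "(q \<longlongrightarrow> p) at_top" "(q \<longlongrightarrow> p) at_bot"
    and p: "\<And>t. (p, t) \<in> lift_set T U" and \<tau>0: "\<And>s. (q s, s + \<tau>0) \<in> lift_set T U"
  obtains \<delta> where "0 < \<delta>" "\<And>\<tau> s. \<tau> \<in> ball \<tau>0 \<delta> \<Longrightarrow> (q s, s + \<tau>) \<in> lift_set T U"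
proof -
  obtain r where r: "0 < r" "\<And>x t. x \<in> ball p r \<Longrightarrow> (x, t) \<in> lift_set T U"
    using ball_times_circle_subset[OF T U p] by blast
  obtain b where b: "\<And>s. b \<le> s \<Longrightarrow> q s \<in> ball p r"
    using tendstoD[OF q(2) r(1)] by (auto simp: eventually_at_top_linorder dist_commute)
  obtain a where a: "\<And>s. s \<le> a \<Longrightarrow> q s \<in> ball p r"
    using tendstoD[OF q(3) r(1)] by (auto simp: eventually_at_bot_linorder dist_commute)
  have "compact ((\<lambda>s. (q s, s + \<tau>0)) ` {a..b})"
  proof (rule compact_continuous_image)
    show "continuous_on {a..b} (\<lambda>s. (q s, s + \<tau>0))"
      using continuous_on_subset[OF q(1), of "{a..b}"]
      by (intro continuous_on_Pair continuous_on_add continuous_on_id continuous_on_const) auto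
  qed simp
  moreover have "(\<lambda>s. (q s, s + \<tau>0)) ` {a..b} \<subseteq> lift_set T U"
    using \<tau>0 by blast
  ultimately obtain \<delta> where \<delta>: "0 < \<delta>"
      "(\<Union>x\<in>(\<lambda>s. (q s, s + \<tau>0)) ` {a..b}. ball x \<delta>) \<subseteq> lift_set T U"
    using compact_subset_open_imp_ball_epsilon_subset[OF _ U] by blast
  have "(q s, s + \<tau>) \<in> lift_set T U" if \<tau>: "\<tau> \<in> ball \<tau>0 \<delta>" for \<tau> s
  proof (cases "s \<in> {a..b}")
    case True
    have "(q s, s + \<tau>) \<in> ball (q s, s + \<tau>0) \<delta>"
      using \<tau> by (simp add: dist_Pair_Pair)
    with \<delta>(2) True show ?thesis
      by blast
  next
    case False
    then show ?thesis
      using a[of s] b[of s] r(2) by auto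
  qed
  with \<delta>(1) show thesis
    by (rule that)
qed

section \<open>Vanishing of the Melnikov function\<close>

theorem theorem4p5:
  fixes T \<epsilon>0 \<tau>0 :: real
    and H :: "real^2 \<Rightarrow> real"
    and g :: "real^2 \<Rightarrow> real \<Rightarrow> real^2"
    and p :: "real^2" and q :: "real \<Rightarrow> real^2"
    and U :: "((real^2) \<times> real set) set"
    and F :: "real \<Rightarrow> (real^2) \<times> real set \<Rightarrow> real"
  assumes T_pos: "0 < T"
    and H_C3: "Ck_on 3 H UNIV"
    and g_C2: "\<And>t. Ck_on 2 (\<lambda>x. g x t) UNIV"
    and g_periodic: "\<And>x t. g x (t + T) = g x t"
    and saddle: "hyperbolic_saddle (ham_field H) p"
    and homoclinic: "homoclinic_orbit (ham_field H) p q"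
    and nbhd: "uniform_nbhd (phase_space T) (orbit_curve T q \<tau>0) U"
    and eps0_pos: "0 < \<epsilon>0"
    and F_C3: "\<And>\<epsilon>. \<epsilon> \<in> {0<..<\<epsilon>0} \<Longrightarrow> Ck_on 3 (lift_fun T (F \<epsilon>)) (lift_set T U)"
    and F_C2_joint: "Ck_on 2 (\<lambda>(\<epsilon>, z). lift_fun T (F \<epsilon>) z) ({0..<\<epsilon>0} \<times> lift_set T U)"
    and F_first_integral: "\<And>\<epsilon>. \<epsilon> \<in> {0<..<\<epsilon>0} \<Longrightarrow>
          first_integral_on (pert_field H g \<epsilon>) (lift_set T U) (lift_fun T (F \<epsilon>))"
    and F_expansion: "\<And>x \<theta>. (x, \<theta>) \<in> U \<Longrightarrow>
          (\<lambda>\<epsilon>. F \<epsilon> (x, \<theta>) - H x) \<in> O[at_right 0](\<lambda>\<epsilon>. \<epsilon>)"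
  shows "\<exists>P. openin (circle T) P \<and> connectedin (circle T) P \<and> coset_mod T \<tau>0 \<in> P \<and>
           (\<forall>\<tau>. coset_mod T \<tau> \<in> P \<longrightarrow>
              melnikov_integrand H g q \<tau> integrable_on UNIV \<and> melnikov H g q \<tau> = 0)"
proof -
  let ?W = "lift_set T U" and ?F = "\<lambda>\<epsilon>. lift_fun T (F \<epsilon>)"
  define K where "K = first_order_coeff F"
  have K: "lift_fun T K = first_order_coeff ?F"
    by (rule ext) (simp add: K_def lift_fun_def first_order_coeff_def case_prod_beta)
  have W: "open ?W"
    using nbhd open_lift_set by (auto simp: uniform_nbhd_def)
  have closure: "phase_space T closure_of orbit_curve T q \<tau>0 \<subseteq> U"
    using nbhd by (simp add: uniform_nbhd_def)
  have q: "\<And>s. (q has_vector_derivative ham_field H (q s)) (at s)" "(q \<longlongrightarrow> p) at_top" "(q \<longlongrightarrow> p) at_bot"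
    using homoclinic by (auto simp: homoclinic_orbit_def)
  have p_in: "(p, t) \<in> ?W" for t
    using closure limit_circle_in_closure[OF T_pos q(2)] by (auto simp: lift_set_def)
  have "orbit_curve T q \<tau>0 \<subseteq> U"
    using closure closure_of_subset[of "orbit_curve T q \<tau>0" "phase_space T"]
    by (auto simp: orbit_curve_def topspace_circle)
  moreover have "(q (s + \<tau>0 - \<tau>0), coset_mod T (s + \<tau>0)) \<in> orbit_curve T q \<tau>0" for s
    unfolding orbit_curve_def by (rule rangeI)
  ultimately have q_in: "(q s, s + \<tau>0) \<in> ?W" for s
    by (auto simp: lift_set_def)
  have H_diff: "H differentiable (at x)" for x
    using Ck_on_SucD(1)[OF H_C3[unfolded numeral_3_eq_3], of x] by (auto simp: differentiable_def)
  have "continuous_on ({0..<\<epsilon>0} \<times> ?W) (\<lambda>(\<epsilon>, z). ?F \<epsilon> z)"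
    using F_C2_joint[unfolded numeral_2_eq_2] by (rule Ck_on_Suc_continuous_on)
  then have F0: "?F 0 (x, t) = H x" if "(x, t) \<in> ?W" for x t
    by (rule limit_parameter_eq[where F = ?F, OF _ that eps0_pos])
      (use F_expansion that in \<open>simp add: lift_fun_def lift_set_def\<close>)
  have K_along: "((\<lambda>s. lift_fun T K (y s, s + \<tau>)) has_vector_derivative - melnikov_integrand H g y \<tau> s) (at s)"
    if "(y has_vector_derivative ham_field H (y s)) (at s)" "(y s, s + \<tau>) \<in> ?W" for y s \<tau>
    unfolding K
    by (rule first_order_coeff_along_unperturbed_solution[OF H_diff F_C2_joint W that(2) eps0_pos
          F_first_integral F0 that(1)])
  have K_cont: "continuous_on ?W (lift_fun T K)"
  proof -
    have "isCont (lift_fun T K) z" if "z \<in> ?W" for z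
      unfolding K
    proof (rule differentiable_imp_continuous_within)
      show "first_order_coeff ?F differentiable at z"
        by (rule first_order_coeff_derivative(1)[OF F_C2_joint W that eps0_pos
              F_first_integral[unfolded pert_field_affine]])
    qed
    then show ?thesis
      by (simp add: continuous_at_imp_continuous_on)
  qed
  have p_eq: "ham_field H p = 0"
    using saddle by (simp add: hyperbolic_saddle_def)
  \<comment> \<open>The rest point \<open>p\<close> is itself an unperturbed solution, with vanishing Melnikov integrand.\<close>
  have "((\<lambda>t. lift_fun T K (p, t)) has_real_derivative 0) (at t)" for t
    using K_along[of "\<lambda>_. p" t 0] p_in p_eq ham_field_eq_0_iff[of H p]
    by (simp add: melnikov_integrand_def has_real_derivative_iff_has_vector_derivative)
  then have p_const: "lift_fun T K (p, t) = lift_fun T K (p, 0)" for t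
    using DERIV_isconst_all by blast
  have K_limit: "((\<lambda>s. lift_fun T K (q s, s + \<tau>)) \<longlongrightarrow> lift_fun T K (p, 0)) A" if "(q \<longlongrightarrow> p) A" for \<tau> A
    by (rule tendsto_of_constant_on_limit_circle[OF T_pos W K_cont p_in p_const that])
  have q_cont: "continuous_on UNIV q"
    using q(1) by (auto intro: continuous_at_imp_continuous_on has_vector_derivative_continuous)
  obtain \<delta> where \<delta>: "0 < \<delta>" "\<And>\<tau> s. \<tau> \<in> ball \<tau>0 \<delta> \<Longrightarrow> (q s, s + \<tau>) \<in> ?W"
    using nearby_phases_stay_in_nbhd[OF T_pos W q_cont q(2,3) p_in q_in] by blast
  let ?P = "coset_mod T ` ball \<tau>0 \<delta>"
  have zero: "(melnikov_integrand H g q \<tau> has_integral 0) UNIV" if \<tau>: "coset_mod T \<tau> \<in> ?P" for \<tau>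
  proof -
    obtain \<tau>' where \<tau>': "\<tau>' \<in> ball \<tau>0 \<delta>" "coset_mod T \<tau> = coset_mod T \<tau>'"
      using \<tau> by auto
    from \<tau>'(2) obtain k :: int where k: "\<tau> = \<tau>' + of_int k * T"
      unfolding coset_mod_eq_iff ..
    have "(q s, s + \<tau>) \<in> ?W" for s
    proof -
      have "coset_mod T (s + \<tau>) = coset_mod T (s + \<tau>')"
        unfolding coset_mod_eq_iff by (rule exI[of _ k]) (simp add: k)
      then show ?thesis
        using \<delta>(2)[OF \<tau>'(1), of s] by (simp add: lift_set_def)
    qed
    then have "((\<lambda>s. - melnikov_integrand H g q \<tau> s) has_integral
        (lift_fun T K (p, 0) - lift_fun T K (p, 0))) UNIV"
      by (intro has_integral_UNIV_of_limits[OF K_along[OF q(1)]] K_limit q(2,3))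
    from has_integral_neg[OF this] show ?thesis
      by simp
  qed
  show ?thesis
  proof (intro exI[of _ ?P] conjI allI impI)
    show "openin (circle T) ?P"
      by (rule openin_circle_image) simp
    show "connectedin (circle T) ?P"
      by (rule connectedin_continuous_map_image[OF quotient_imp_continuous_map[OF quotient_map_coset_mod]])
        simp
    show "coset_mod T \<tau>0 \<in> ?P"
      using \<delta>(1) by simp
    fix \<tau> assume "coset_mod T \<tau> \<in> ?P"
    from zero[OF this]
    show "melnikov_integrand H g q \<tau> integrable_on UNIV" "melnikov H g q \<tau> = 0"
      by (auto simp: integrable_on_def melnikov_def integral_unique)
  qed
qed

end
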